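(* Let $\mathcal Z,S,T,Z,\|\cdot\|,w,m,M,\mu$ be as in the context, and let $\{(z_k,\tilde z_k,\lambda_k,\varepsilon_k,\eta_k)\}$ be generated by Framework 1 (described in the context) with data $z_0\in Z$, $\eta_0\ge0$, $\sigma\in[0,1)$, $\tau\in(0,1)$, $\lambda>0$. Let $$\underline\tau:=\min\left\{\frac mM\left(\frac1{1-\sigma}+\frac1{\mu\lambda}\right)^{-1},\tau\right\},\qquad\underline d_0:=\inf\{(dw)_{z_0}(z):z\in(S+T)^{-1}(0)\}.$$ Then, for every $k\ge1$, $r_k\in(S+T^{[\varepsilon_k]})(\tilde z_k)$ and $$\|r_k\|^*\le\frac{2\sqrt2M}{\lambda\sqrt m}(1-\underline\tau)^{(k-1)/2}\sqrt{\underline d_0+\eta_0},\qquad\varepsilon_k\le\frac1{\lambda(1-\sigma)}(1-\underline\tau)^{k-1}[\underline d_0+\eta_0].$$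
   Context: $\mathcal Z$ is a finite-dimensional real inner product space. A proper lower semicontinuous convex $w:\mathcal Z\to[-\infty,\infty]$ is a distance generating function if $\mathrm{int}(\mathrm{dom}\,w)=\mathrm{Dom}(\partial w)\ne\emptyset$ and $w$ is continuously differentiable on this interior; its Bregman distance is $(dw)_z(z')=w(z')-w(z)-\langle\nabla w(z),z'-z\rangle$ for $z\in\mathrm{int}(\mathrm{dom}\,w)$, $z'\in\mathcal Z$; $\nabla(dw)_z(z')=\nabla w(z')-\nabla w(z)$. For a seminorm $\|\cdot\|$ on $\mathcal Z$, $\|v\|^*=\sup\{\langle v,z\rangle:\|z\|\le1\}\in[0,\infty]$. Given a convex set $Z\subset\mathrm{int}(\mathrm{dom}\,w)$ and constants $m,M>0$, $w$ is $(m,M)$-regular with respect to $(Z,\|\cdot\|)$ if $(dw)_z(z')\ge\frac m2\|z-z'\|^2$ and $\|\nabla w(z)-\nabla w(z')\|^*\le M\|z-z'\|$ for all $z,z'\in Z$. For a monotone $T:\mathcal Z\rightrightarrows\mathcal Z$ and $\varepsilon\ge0$, $T^{[\varepsilon]}(z)=\{v:\langle v-v',z-z'\rangle\ge-\varepsilon\ \forall z'\in\mathcal Z,\ \forall v'\in T(z')\}$. Standing assumptions: $w$ is an $(m,M)$-regular distance generating function with respect to $(Z,\|\cdot\|)$, with $Z\subset\mathrm{int}(\mathrm{dom}\,w)$ convex and $\|\cdot\|$ a seminorm; $S,T:\mathcal Z\rightrightarrows\mathcal Z$ are maximal monotone with $\mathrm{Dom}(T)\subset Z$; $S$ is $\mu$-monotone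 on $Z$ with respect to $w$ for some $\mu>0$, i.e. $\langle z-z',s-s'\rangle\ge\mu[(dw)_z(z')+(dw)_{z'}(z)]$ for all $z,z'\in Z$, $s\in S(z)$, $s'\in S(z')$; and $(S+T)^{-1}(0)\ne\emptyset$. Framework 1: given $z_0\in Z$, $\eta_0\ge0$, $\sigma\in[0,1)$, $\tau\in(0,1)$, $\lambda>0$, for each $k\ge1$ choose $\lambda_k\ge\lambda$ and find $(\tilde z_k,z_k,\varepsilon_k,\eta_k)\in Z\times Z\times\mathbb R_+\times\mathbb R_+$ such that $$r_k:=\tfrac1{\lambda_k}\nabla(dw)_{z_k}(z_{k-1})\in\big(S+T^{[\varepsilon_k]}\big)(\tilde z_k),$$ $$(dw)_{z_k}(\tilde z_k)+\lambda_k\varepsilon_k+\eta_k\le\sigma(dw)_{z_{k-1}}(\tilde z_k)+(1-\tau)\eta_{k-1}.$$ *)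

theory Defs
  imports "HOL-Analysis.Analysis" "HOL-Library.Set_Algebras"
begin

definition edom :: "('a \<Rightarrow> ereal) \<Rightarrow> 'a set" where
  "edom f = {x. f x < \<infinity>}"

definition proper :: "('a \<Rightarrow> ereal) \<Rightarrow> bool" where
  "proper f \<longleftrightarrow> (\<forall>x. f x \<noteq> -\<infinity>) \<and> (\<exists>x. f x \<noteq> \<infinity>)"

definition lsc :: "('a::euclidean_space \<Rightarrow> ereal) \<Rightarrow> bool" where
  "lsc f \<longleftrightarrow> (\<forall>x. f x \<le> Liminf (at x) f)"

text \<open>Convexity is expressed by the epigraph, which avoids arithmetic with infinite values.\<close>

definition econvex :: "('a::euclidean_space \<Rightarrow> ereal) \<Rightarrow> bool" where
  "econvex f \<longleftrightarrow> convex {(x, r::real). f x \<le> ereal r}"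

definition subdifferential :: "('a::euclidean_space \<Rightarrow> ereal) \<Rightarrow> 'a \<Rightarrow> 'a set" where
  "subdifferential f x = {v. \<forall>y. f x + ereal (v \<bullet> (y - x)) \<le> f y}"

text \<open>Meaningful only at points near which \<open>f\<close> is finite and at which it is differentiable;
  \<open>real_of_ereal\<close> sends infinite values to 0.\<close>

definition has_egradient :: "('a::euclidean_space \<Rightarrow> ereal) \<Rightarrow> 'a \<Rightarrow> 'a \<Rightarrow> bool" where
  "has_egradient f g x \<longleftrightarrow> GDERIV (\<lambda>y. real_of_ereal (f y)) x :> g"

definition egradient :: "('a::euclidean_space \<Rightarrow> ereal) \<Rightarrow> 'a \<Rightarrow> 'a" where
  "egradient f x = (THE g. has_egradient f g x)"

definition op_dom :: "('a \<Rightarrow> 'b set) \<Rightarrow> 'a set" where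
  "op_dom T = {z. T z \<noteq> {}}"

definition op_zeros :: "('a \<Rightarrow> 'b::zero set) \<Rightarrow> 'a set" where
  "op_zeros T = {z. 0 \<in> T z}"

text \<open>The right-hand side is the Minkowski sum of sets.\<close>

definition op_sum :: "('a \<Rightarrow> 'b::plus set) \<Rightarrow> ('a \<Rightarrow> 'b set) \<Rightarrow> 'a \<Rightarrow> 'b set" where
  "op_sum S T z = S z + T z"

definition monotone_op :: "('a::euclidean_space \<Rightarrow> 'a set) \<Rightarrow> bool" where
  "monotone_op T \<longleftrightarrow> (\<forall>z z'. \<forall>v\<in>T z. \<forall>v'\<in>T z'. 0 \<le> (v - v') \<bullet> (z - z'))"

definition maximal_monotone :: "('a::euclidean_space \<Rightarrow> 'a set) \<Rightarrow> bool" where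
  "maximal_monotone T \<longleftrightarrow>
     monotone_op T \<and> (\<forall>T'. monotone_op T' \<and> (\<forall>z. T z \<subseteq> T' z) \<longrightarrow> T' = T)"

definition enlargement :: "('a::euclidean_space \<Rightarrow> 'a set) \<Rightarrow> real \<Rightarrow> 'a \<Rightarrow> 'a set" where
  "enlargement T \<epsilon> z = {v. \<forall>z'. \<forall>v'\<in>T z'. - \<epsilon> \<le> (v - v') \<bullet> (z - z')}"

definition is_seminorm :: "('a::real_vector \<Rightarrow> real) \<Rightarrow> bool" where
  "is_seminorm p \<longleftrightarrow>
     (\<forall>x. 0 \<le> p x) \<and> (\<forall>x y. p (x + y) \<le> p x + p y) \<and> (\<forall>c x. p (c *\<^sub>R x) = \<bar>c\<bar> * p x)"

definition dual_seminorm :: "('a::euclidean_space \<Rightarrow> real) \<Rightarrow> 'a \<Rightarrow> ereal" where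
  "dual_seminorm p v = (SUP z\<in>{z. p z \<le> 1}. ereal (v \<bullet> z))"

definition distance_generating :: "('a::euclidean_space \<Rightarrow> ereal) \<Rightarrow> bool" where
  "distance_generating w \<longleftrightarrow>
     proper w \<and> lsc w \<and> econvex w \<and>
     interior (edom w) = op_dom (subdifferential w) \<and> interior (edom w) \<noteq> {} \<and>
     (\<forall>z\<in>interior (edom w). \<exists>g. has_egradient w g z) \<and>
     continuous_on (interior (edom w)) (egradient w)"

text \<open>\<open>bregman w z z'\<close> is $(dw)_z(z')$: the base point comes first.
  It is meant for base points in the interior of the domain of \<open>w\<close>.\<close>

definition bregman :: "('a::euclidean_space \<Rightarrow> ereal) \<Rightarrow> 'a \<Rightarrow> 'a \<Rightarrow> ereal" where
  "bregman w z z' = w z' - w z - ereal (egradient w z \<bullet> (z' - z))"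

definition regular_wrt ::
  "('a::euclidean_space \<Rightarrow> ereal) \<Rightarrow> real \<Rightarrow> real \<Rightarrow> 'a set \<Rightarrow> ('a \<Rightarrow> real) \<Rightarrow> bool" where
  "regular_wrt w m M Z p \<longleftrightarrow>
     (\<forall>z\<in>Z. \<forall>z'\<in>Z.
        ereal (m / 2 * (p (z - z'))\<^sup>2) \<le> bregman w z z' \<and>
        dual_seminorm p (egradient w z - egradient w z') \<le> ereal (M * p (z - z')))"

definition bregman_monotone_on ::
  "('a::euclidean_space \<Rightarrow> ereal) \<Rightarrow> real \<Rightarrow> 'a set \<Rightarrow> ('a \<Rightarrow> 'a set) \<Rightarrow> bool" where
  "bregman_monotone_on w \<mu> Z S \<longleftrightarrow>
     (\<forall>z\<in>Z. \<forall>z'\<in>Z. \<forall>s\<in>S z. \<forall>s'\<in>S z'.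
        ereal \<mu> * (bregman w z z' + bregman w z' z) \<le> ereal ((z - z') \<bullet> (s - s')))"

definition residual ::
  "('a::euclidean_space \<Rightarrow> ereal) \<Rightarrow> (nat \<Rightarrow> 'a) \<Rightarrow> (nat \<Rightarrow> real) \<Rightarrow> nat \<Rightarrow> 'a" where
  "residual w z lam k = (1 / lam k) *\<^sub>R egradient (bregman w (z k)) (z (k - 1))"

text \<open>The starting data $z_0$, $\eta_0$ are the entries \<open>z 0\<close>, \<open>\<eta> 0\<close> of the sequences; the entries
  of \<open>zt\<close> (the points $\tilde z_k$), \<open>lam\<close> and \<open>\<epsilon>\<close> at index 0 are irrelevant.
  The lower bound $\lambda$ on the stepsizes is \<open>lam_min\<close>.\<close>

definition framework1 ::
  "('a::euclidean_space \<Rightarrow> ereal) \<Rightarrow> ('a \<Rightarrow> 'a set) \<Rightarrow> ('a \<Rightarrow> 'a set) \<Rightarrow> 'a set \<Rightarrow>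
   real \<Rightarrow> real \<Rightarrow> real \<Rightarrow>
   (nat \<Rightarrow> 'a) \<Rightarrow> (nat \<Rightarrow> 'a) \<Rightarrow> (nat \<Rightarrow> real) \<Rightarrow> (nat \<Rightarrow> real) \<Rightarrow> (nat \<Rightarrow> real) \<Rightarrow> bool" where
  "framework1 w S T Z \<sigma> \<tau> lam_min z zt lam \<epsilon> \<eta> \<longleftrightarrow>
     z 0 \<in> Z \<and> 0 \<le> \<eta> 0 \<and> 0 \<le> \<sigma> \<and> \<sigma> < 1 \<and> 0 < \<tau> \<and> \<tau> < 1 \<and> 0 < lam_min \<and>
     (\<forall>k\<ge>1.
        lam_min \<le> lam k \<and> zt k \<in> Z \<and> z k \<in> Z \<and> 0 \<le> \<epsilon> k \<and> 0 \<le> \<eta> k \<and>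
        residual w z lam k \<in> op_sum S (enlargement T (\<epsilon> k)) (zt k) \<and>
        bregman w (z k) (zt k) + ereal (lam k * \<epsilon> k + \<eta> k)
          \<le> ereal \<sigma> * bregman w (z (k - 1)) (zt k) + ereal ((1 - \<tau>) * \<eta> (k - 1)))"

end

theory Submission
  imports Defs
begin

text \<open>Fix a zero \<open>x\<close> of \<open>S + T\<close>. Since \<open>lam k\<close> times the residual is a difference of gradients of
  \<open>w\<close>, the three-point identity turns the decrease of the Bregman distance to \<open>x\<close> into an inner
  product that the \<open>\<mu>\<close>-monotonicity of \<open>S\<close> and the enlargement inequality bound from below; the
  error criterion absorbs the remaining terms. The gain
  \<open>(1 - \<sigma>) D(z (k - 1), zt k) + \<mu> lam_min D(zt k, x)\<close> dominates a multiple of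
  \<open>p (z (k - 1) - x)\<^sup>2\<close> by Cauchy-Schwarz, hence of \<open>D(z (k - 1), x)\<close> because \<open>D\<close> is at most
  \<open>M / 2\<close> times the squared seminorm. So \<open>D(z k, x) + \<eta> k\<close> contracts linearly. The seminorm of a
  step is bounded by going through \<open>x\<close>, and the bounds, being continuous in \<open>D(z 0, x)\<close>, pass to
  the infimum over \<open>x\<close>.\<close>

section \<open>Real-valued Bregman distance and its gradients\<close>

text \<open>Agrees with \<open>bregman\<close> only where \<open>w\<close> is finite at both points.\<close>

definition breg :: "('a::euclidean_space \<Rightarrow> ereal) \<Rightarrow> 'a \<Rightarrow> 'a \<Rightarrow> real" where
  "breg w z x = real_of_ereal (w x) - real_of_ereal (w z) - egradient w z \<bullet> (x - z)"

lemma ereal_real_edom: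
  assumes "proper w" "x \<in> edom w"
  shows "w x = ereal (real_of_ereal (w x))"
  using assms by (cases "w x") (auto simp: proper_def edom_def)

lemma bregman_eq_breg:
  assumes "proper w" "z \<in> edom w" "x \<in> edom w"
  shows "bregman w z x = ereal (breg w z x)"
proof -
  obtain a b where "w z = ereal a" "w x = ereal b"
    by (rule that[OF ereal_real_edom[OF assms(1,2)] ereal_real_edom[OF assms(1,3)]])
  then show ?thesis by (simp add: bregman_def breg_def)
qed

text \<open>Derivatives are unique and the inner product separates points, so the definite
  description in \<open>egradient\<close> is determined.\<close>

lemma egradient_eqI:
  assumes "has_egradient f g x"
  shows "egradient f x = g"
proof -
  have "g' = g" if "has_egradient f g' x" for g'
  proof -
    have "(\<lambda>h. g' \<bullet> h) = (\<lambda>h. g \<bullet> h)"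
      using that assms unfolding has_egradient_def gderiv_def
      by (metis (no_types) has_derivative_unique inner_commute)
    then show ?thesis
      by (metis vector_eq_rdot)
  qed
  with assms show ?thesis
    unfolding egradient_def by (rule the_equality)
qed

text \<open>The residual is defined through this gradient. Near an interior point
  \<open>bregman\<close> is finite and equals \<open>breg\<close>, whose derivative is explicit, and
  differentiability is local.\<close>

lemma egradient_bregman:
  assumes w: "proper w" and z: "z \<in> edom w" and x: "x \<in> interior (edom w)"
    and g: "has_egradient w g x"
  shows "egradient (bregman w z) x = g - egradient w z"
proof (rule egradient_eqI)
  have "((\<lambda>y. breg w z y) has_derivative (\<lambda>h. h \<bullet> g - egradient w z \<bullet> h)) (at x)"
    unfolding breg_def
    by (rule derivative_eq_intros g[unfolded has_egradient_def gderiv_def] refl | simp)+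
  then have "((\<lambda>y. real_of_ereal (bregman w z y)) has_derivative
      (\<lambda>h. h \<bullet> g - egradient w z \<bullet> h)) (at x)"
  proof (rule has_derivative_transform_within_open[OF _ open_interior x])
    fix y assume "y \<in> interior (edom w)"
    then show "breg w z y = real_of_ereal (bregman w z y)"
      using bregman_eq_breg[OF w z, of y] interior_subset by fastforce
  qed
  then show "has_egradient (bregman w z) (g - egradient w z) x"
    unfolding has_egradient_def gderiv_def by (simp add: inner_diff_right inner_commute)
qed

section \<open>Seminorms, dual bounds and the quadratic upper estimate\<close>

lemma seminorm_minus_commute:
  assumes "is_seminorm p"
  shows "p (x - y) = p (y - x)"
proof -
  have "p ((- 1) *\<^sub>R (y - x)) = \<bar>- 1\<bar> * p (y - x)"
    using assms unfolding is_seminorm_def by blast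
  then show ?thesis by simp
qed

text \<open>Generalized Cauchy-Schwarz: scale \<open>u\<close> to seminorm 1. If
  \<open>p u = 0\<close>, the whole line through \<open>u\<close> lies in the unit ball, and a
  linear functional bounded above on a line vanishes there.\<close>

lemma inner_le_dual_seminorm:
  assumes p: "is_seminorm p" and v: "dual_seminorm p v \<le> ereal c"
  shows "v \<bullet> u \<le> c * p u"
proof -
  have scale: "p (t *\<^sub>R u) = \<bar>t\<bar> * p u" for t
    using p by (auto simp: is_seminorm_def)
  have nonneg: "0 \<le> p u"
    using p by (auto simp: is_seminorm_def)
  have ball: "v \<bullet> y \<le> c" if "p y \<le> 1" for y
  proof -
    have "ereal (v \<bullet> y) \<le> dual_seminorm p v"
      unfolding dual_seminorm_def by (rule SUP_upper) (use that in simp)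
    then show ?thesis using v by (metis ereal_less_eq(3) order_trans)
  qed
  show ?thesis
  proof (cases "p u = 0")
    case True
    have "t * (v \<bullet> u) \<le> c" for t
      using ball[of "t *\<^sub>R u"] scale True by simp
    \<comment> \<open>If \<open>v \<bullet> u\<close> were nonzero, this factor would make the left
      side \<open>\<bar>c\<bar> + 1\<close>, which exceeds \<open>c\<close>.\<close>
    from this[of "(\<bar>c\<bar> + 1) / (v \<bullet> u)"] have "v \<bullet> u = 0"
      by (cases "v \<bullet> u = 0") auto
    then show ?thesis using True by simp
  next
    case False
    with nonneg have "0 < p u" by simp
    then show ?thesis
      using ball[of "(1 / p u) *\<^sub>R u"] scale by (simp add: field_simps)
  qed
qed

text \<open>Along the segment from \<open>z\<close> to \<open>x\<close>, which stays in
  \<open>Z\<close> by convexity, a monotonicity argument takes the place of integrating the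
  Lipschitz bound on the gradient.\<close>

lemma breg_le_smooth:
  assumes p: "is_seminorm p"
    and Z: "convex Z" "Z \<subseteq> interior (edom w)"
    and diff: "\<And>y. y \<in> interior (edom w) \<Longrightarrow> has_egradient w (egradient w y) y"
    and lip: "\<And>x y. x \<in> Z \<Longrightarrow> y \<in> Z \<Longrightarrow>
      dual_seminorm p (egradient w x - egradient w y) \<le> ereal (M * p (x - y))"
    and "z \<in> Z" "x \<in> Z"
  shows "breg w z x \<le> M / 2 * (p (z - x))\<^sup>2"
proof -
  define u where "u = x - z"
  define \<gamma> where "\<gamma> t = z + t *\<^sub>R u" for t
  \<comment> \<open>\<open>\<psi> 1 - \<psi> 0\<close> is exactly
    \<open>breg w z x - M / 2 * (p u)\<^sup>2\<close>.\<close>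
  define \<psi> where
    "\<psi> t = real_of_ereal (w (\<gamma> t)) - t * (egradient w z \<bullet> u) - M / 2 * t\<^sup>2 * (p u)\<^sup>2" for t
  have \<gamma>Z: "\<gamma> t \<in> Z" if "0 \<le> t" "t \<le> 1" for t
  proof -
    have "\<gamma> t = (1 - t) *\<^sub>R z + t *\<^sub>R x"
      by (simp add: \<gamma>_def u_def algebra_simps)
    then show ?thesis
      using convexD_alt[OF Z(1) \<open>z \<in> Z\<close> \<open>x \<in> Z\<close> that] by simp
  qed
  have "\<psi> 1 \<le> \<psi> 0"
  proof (rule DERIV_nonpos_imp_nonincreasing[of 0 1 \<psi>])
    fix t :: real assume t: "0 \<le> t" "t \<le> 1"
    have "((\<lambda>y. real_of_ereal (w y)) has_derivative (\<lambda>h. h \<bullet> egradient w (\<gamma> t))) (at (\<gamma> t))"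
      using diff[of "\<gamma> t"] \<gamma>Z[OF t] Z(2) by (auto simp: has_egradient_def gderiv_def)
    moreover have "(\<gamma> has_derivative (\<lambda>h. h *\<^sub>R u)) (at t)"
      unfolding \<gamma>_def by (auto intro!: derivative_eq_intros)
    ultimately have "((\<lambda>t. real_of_ereal (w (\<gamma> t))) has_derivative
        (\<lambda>h. (h *\<^sub>R u) \<bullet> egradient w (\<gamma> t))) (at t)"
      by (rule has_derivative_compose[rotated])
    then have "((\<lambda>t. real_of_ereal (w (\<gamma> t))) has_real_derivative u \<bullet> egradient w (\<gamma> t)) (at t)"
      by (simp add: has_field_derivative_def mult_commute_abs)
    then have "(\<psi> has_real_derivative
        u \<bullet> egradient w (\<gamma> t) - egradient w z \<bullet> u - M * t * (p u)\<^sup>2) (at t)"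
      unfolding \<psi>_def by (auto intro!: derivative_eq_intros)
    moreover have "(egradient w (\<gamma> t) - egradient w z) \<bullet> u \<le> M * p (\<gamma> t - z) * p u"
      by (intro inner_le_dual_seminorm[OF p] lip \<gamma>Z t \<open>z \<in> Z\<close>)
    then have "u \<bullet> egradient w (\<gamma> t) - egradient w z \<bullet> u - M * t * (p u)\<^sup>2 \<le> 0"
      using p t by (simp add: \<gamma>_def is_seminorm_def inner_diff_left inner_commute
          power2_eq_square algebra_simps)
    ultimately show "\<exists>d. DERIV \<psi> t :> d \<and> d \<le> 0" by blast
  qed simp
  then show ?thesis
    by (simp add: \<psi>_def \<gamma>_def breg_def u_def seminorm_minus_commute[OF p, of z x])
qed

section \<open>Auxiliary facts on real inequalities and infima\<close>

text \<open>The factor is \<open>\<alpha> * \<beta> / (\<alpha> + \<beta>)\<close>, the minimum of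
  the right side over \<open>a + b = 1\<close>. After multiplication by
  \<open>\<alpha> + \<beta>\<close>, the defect at \<open>c = a + b\<close> is the square of
  \<open>\<alpha> * a - \<beta> * b\<close>.\<close>

lemma weighted_square_sum:
  fixes \<alpha> \<beta> a b c :: real
  assumes "0 < \<alpha>" "0 < \<beta>" "0 \<le> c" "c \<le> a + b"
  shows "inverse (1 / \<alpha> + 1 / \<beta>) * c\<^sup>2 \<le> \<alpha> * a\<^sup>2 + \<beta> * b\<^sup>2"
proof -
  have "c\<^sup>2 \<le> (a + b)\<^sup>2" using assms by (intro power_mono) auto
  then have "\<alpha> * \<beta> * c\<^sup>2 \<le> \<alpha> * \<beta> * (a + b)\<^sup>2" using assms by simp
  also have "\<dots> \<le> (\<alpha> + \<beta>) * (\<alpha> * a\<^sup>2 + \<beta> * b\<^sup>2)"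
    using zero_le_power2[of "\<alpha> * a - \<beta> * b"] by (simp add: power2_eq_square algebra_simps)
  finally have "\<alpha> * \<beta> / (\<alpha> + \<beta>) * c\<^sup>2 \<le> \<alpha> * a\<^sup>2 + \<beta> * b\<^sup>2"
    using assms by (simp add: field_simps)
  moreover have "inverse (1 / \<alpha> + 1 / \<beta>) = \<alpha> * \<beta> / (\<alpha> + \<beta>)"
    using assms by (simp add: field_simps)
  ultimately show ?thesis by simp
qed

text \<open>The bound holds on a closed set of \<open>d\<close>, and the infimum lies in the closure
  of \<open>A\<close>.\<close>

lemma le_continuous_Inf:
  fixes f :: "real \<Rightarrow> real"
  assumes "continuous_on UNIV f" "A \<noteq> {}" "bdd_below A" "\<And>d. d \<in> A \<Longrightarrow> X \<le> f d"
  shows "X \<le> f (Inf A)"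
proof -
  have "closed {d. X \<le> f d}"
    using assms(1) by (intro closed_Collect_le) auto
  then have "closure A \<subseteq> {d. X \<le> f d}"
    using assms(4) by (intro closure_minimal) auto
  then show ?thesis
    using closure_contains_Inf[OF assms(2,3)] by auto
qed

text \<open>A nonempty family of nonnegative reals has a finite infimum, so
  \<open>real_of_ereal\<close> does not fall back to its default 0.\<close>

lemma real_of_ereal_INF:
  fixes f :: "'a \<Rightarrow> real"
  assumes "A \<noteq> {}" "\<And>x. x \<in> A \<Longrightarrow> 0 \<le> f x"
  shows "real_of_ereal (INF x\<in>A. ereal (f x)) = Inf (f ` A)"
proof -
  have "0 \<le> (INF x\<in>A. ereal (f x))" using assms by (intro INF_greatest) auto
  moreover obtain x where "x \<in> A" using assms by blast
  then have "(INF x\<in>A. ereal (f x)) \<le> ereal (f x)" by (rule INF_lower)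
  ultimately have "\<bar>INF x\<in>A. ereal (f x)\<bar> \<noteq> \<infinity>" by auto
  then have "ereal (Inf (f ` A)) = (INF x\<in>A. ereal (f x))"
    using ereal_Inf[of "f ` A"] by (simp add: image_image)
  then show ?thesis by (metis real_of_ereal.simps(1))
qed


section \<open>Three-point identity and regularity along the iterates\<close>

text \<open>The values of \<open>w\<close> at \<open>x\<close> cancel on the left, which is
  therefore affine in \<open>x\<close> with slope
  \<open>egradient w b - egradient w a\<close>.\<close>

lemma breg_three_point:
  "breg w a x - breg w b x =
    breg w a y - breg w b y + (egradient w a - egradient w b) \<bullet> (y - x)"
  by (simp add: breg_def inner_diff_left inner_diff_right)

locale hpe_regular =
  fixes w :: "'a::euclidean_space \<Rightarrow> ereal" and p :: "'a \<Rightarrow> real" and Z :: "'a set"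
    and S T :: "'a \<Rightarrow> 'a set" and m M \<mu> \<sigma> \<tau> lam_min :: real
    and z zt :: "nat \<Rightarrow> 'a" and lam \<epsilon> \<eta> :: "nat \<Rightarrow> real"
  assumes dgf: "distance_generating w" and p: "is_seminorm p"
    and Z: "convex Z" "Z \<subseteq> interior (edom w)"
    and m: "0 < m" and M: "0 < M" and regular: "regular_wrt w m M Z p"
    and dom_T: "op_dom T \<subseteq> Z"
    and \<mu>: "0 < \<mu>" and mono_S: "bregman_monotone_on w \<mu> Z S"
    and fw: "framework1 w S T Z \<sigma> \<tau> lam_min z zt lam \<epsilon> \<eta>"
begin

lemma params: "0 \<le> \<sigma>" "\<sigma> < 1" "0 < \<tau>" "\<tau> < 1" "0 < lam_min" "0 \<le> \<eta> 0"
  using fw unfolding framework1_def by blast+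

lemma iterate:
  assumes "1 \<le> k"
  shows "lam_min \<le> lam k" "zt k \<in> Z" "0 \<le> \<epsilon> k"
    "residual w z lam k \<in> op_sum S (enlargement T (\<epsilon> k)) (zt k)"
  using fw assms unfolding framework1_def by blast+

lemma \<eta>_nonneg: "0 \<le> \<eta> k" and z_in_Z: "z k \<in> Z"
proof -
  have "k = 0 \<or> 1 \<le> k" by auto
  then show "0 \<le> \<eta> k" "z k \<in> Z"
    using fw unfolding framework1_def by blast+
qed

lemma bregman_Z: "bregman w x y = ereal (breg w x y)" if "x \<in> Z" "y \<in> Z"
proof (rule bregman_eq_breg)
  show "proper w" using dgf unfolding distance_generating_def by blast
qed (use that Z(2) interior_subset in blast)+

lemma has_egradient_interior:
  assumes "x \<in> interior (edom w)"
  shows "has_egradient w (egradient w x) x"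
  using assms dgf egradient_eqI unfolding distance_generating_def by metis

lemma breg_ge: "m / 2 * (p (x - y))\<^sup>2 \<le> breg w x y" if "x \<in> Z" "y \<in> Z"
proof -
  have "ereal (m / 2 * (p (x - y))\<^sup>2) \<le> bregman w x y"
    using regular that unfolding regular_wrt_def by blast
  then show ?thesis by (simp add: bregman_Z that)
qed

lemma breg_nonneg: "0 \<le> breg w x y" if "x \<in> Z" "y \<in> Z"
  by (rule order_trans[OF _ breg_ge[OF that]]) (use m in simp)

lemma egradient_lipschitz:
  "dual_seminorm p (egradient w x - egradient w y) \<le> ereal (M * p (x - y))"
  if "x \<in> Z" "y \<in> Z"
  using regular that unfolding regular_wrt_def by blast

lemma breg_le: "breg w x y \<le> M / 2 * (p (x - y))\<^sup>2" if "x \<in> Z" "y \<in> Z"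
  using breg_le_smooth[OF p Z has_egradient_interior egradient_lipschitz that] .

lemma seminorm_nonneg: "0 \<le> p x"
  using p unfolding is_seminorm_def by blast

lemma seminorm_triangle: "p (x - y) \<le> p (x - v) + p (v - y)"
proof -
  have "p ((x - v) + (v - y)) \<le> p (x - v) + p (v - y)"
    using p unfolding is_seminorm_def by blast
  then show ?thesis by simp
qed

lemma residual_eq:
  "residual w z lam k = (1 / lam k) *\<^sub>R (egradient w (z (k - 1)) - egradient w (z k))"
proof -
  have "z k \<in> edom w" "z (k - 1) \<in> interior (edom w)"
    using z_in_Z Z(2) interior_subset by blast+
  then show ?thesis
    unfolding residual_def
    using egradient_bregman has_egradient_interior dgf unfolding distance_generating_def by metis
qed

text \<open>At a zero of the sum \<open>T\<close> has a nonempty value, so regularity is available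
  there.\<close>

lemma zeros_subset: "op_zeros (op_sum S T) \<subseteq> Z"
  using dom_T unfolding op_zeros_def op_sum_def op_dom_def set_plus_def by auto

lemma error_criterion:
  assumes "1 \<le> k"
  shows "breg w (z k) (zt k) + lam k * \<epsilon> k + \<eta> k
    \<le> \<sigma> * breg w (z (k - 1)) (zt k) + (1 - \<tau>) * \<eta> (k - 1)"
proof -
  have "bregman w (z k) (zt k) + ereal (lam k * \<epsilon> k + \<eta> k)
      \<le> ereal \<sigma> * bregman w (z (k - 1)) (zt k) + ereal ((1 - \<tau>) * \<eta> (k - 1))"
    using fw assms unfolding framework1_def by blast
  then show ?thesis using iterate(2)[OF assms] by (simp add: bregman_Z z_in_Z)
qed

section \<open>Descent and linear contraction\<close>

text \<open>Split the residual as \<open>s + v\<close> at \<open>zt k\<close> and 0 as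
  \<open>s' + v'\<close> at \<open>x\<close>. The enlargement costs \<open>\<epsilon> k\<close>; of
  the two Bregman terms from \<open>S\<close> one is kept and the other, being nonnegative,
  dropped.\<close>

lemma residual_inner_ge:
  assumes "1 \<le> k" and x: "x \<in> op_zeros (op_sum S T)"
  shows "\<mu> * breg w (zt k) x - \<epsilon> k \<le> residual w z lam k \<bullet> (zt k - x)"
proof -
  have xZ: "x \<in> Z" using x zeros_subset by blast
  obtain s v where s: "s \<in> S (zt k)" and v: "v \<in> enlargement T (\<epsilon> k) (zt k)"
    and r: "residual w z lam k = s + v"
    using iterate(4)[OF assms(1)] unfolding op_sum_def set_plus_def by blast
  obtain s' v' where s': "s' \<in> S x" and v': "v' \<in> T x" and "s' + v' = 0"
    using x unfolding op_zeros_def op_sum_def set_plus_def by auto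
  then have v'_eq: "v' = - s'" by (simp add: add_eq_0_iff)
  have "ereal \<mu> * (bregman w (zt k) x + bregman w x (zt k)) \<le> ereal ((zt k - x) \<bullet> (s - s'))"
    using mono_S s s' xZ iterate(2)[OF assms(1)] unfolding bregman_monotone_on_def by blast
  then have "\<mu> * (breg w (zt k) x + breg w x (zt k)) \<le> (s - s') \<bullet> (zt k - x)"
    using iterate(2)[OF assms(1)] xZ by (simp add: bregman_Z inner_commute)
  moreover have "0 \<le> \<mu> * breg w x (zt k)"
    using \<mu> breg_nonneg[OF xZ iterate(2)[OF assms(1)]] by simp
  moreover have "- \<epsilon> k \<le> (v - v') \<bullet> (zt k - x)"
    using v v' unfolding enlargement_def by blast
  ultimately show ?thesis
    by (simp add: r v'_eq inner_add_left inner_diff_left distrib_left)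
qed

text \<open>In the three-point identity at \<open>zt k\<close>, the gradient difference is
  \<open>lam k\<close> times the residual. The resulting loss \<open>lam k * \<epsilon> k\<close> is
  cancelled by the same term in the error criterion.\<close>

lemma descent:
  assumes "1 \<le> k" and x: "x \<in> op_zeros (op_sum S T)"
  shows "breg w (z k) x + \<eta> k + (1 - \<sigma>) * breg w (z (k - 1)) (zt k) + \<mu> * lam_min * breg w (zt k) x
    \<le> breg w (z (k - 1)) x + (1 - \<tau>) * \<eta> (k - 1)"
proof -
  have xZ: "x \<in> Z" using x zeros_subset by blast
  note it = iterate[OF assms(1)]
  have pos: "0 < lam k" using it(1) params by linarith
  have "lam k * (\<mu> * breg w (zt k) x - \<epsilon> k) \<le> lam k * (residual w z lam k \<bullet> (zt k - x))"
    using residual_inner_ge[OF assms] pos by simp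
  also have "\<dots> = (egradient w (z (k - 1)) - egradient w (z k)) \<bullet> (zt k - x)"
    using pos by (simp add: residual_eq)
  finally have "lam k * \<mu> * breg w (zt k) x - lam k * \<epsilon> k
      \<le> (egradient w (z (k - 1)) - egradient w (z k)) \<bullet> (zt k - x)"
    by (simp add: algebra_simps)
  moreover have "\<mu> * lam_min * breg w (zt k) x \<le> lam k * \<mu> * breg w (zt k) x"
    using it(1) \<mu> breg_nonneg[OF it(2) xZ] by (intro mult_right_mono) auto
  ultimately show ?thesis
    using breg_three_point[of w "z (k - 1)" x "z k" "zt k"] error_criterion[OF assms(1)]
    by (simp add: algebra_simps)
qed

text \<open>The constant \<open>\<tau>\<^sub>0\<close> of the theorem: the first entry of the
  minimum serves the Bregman part of the energy, \<open>\<tau>\<close> the part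
  \<open>\<eta>\<close>.\<close>

definition rate :: real where
  "rate = min (m / M * inverse (1 / (1 - \<sigma>) + 1 / (\<mu> * lam_min))) \<tau>"

lemma rate_bounds: "rate \<le> \<tau>" "rate < 1"
  using params by (auto simp: rate_def)

text \<open>The ratio \<open>m / M\<close> arises because Bregman distances are bounded above by
  \<open>M / 2\<close> times a squared seminorm before the triangle inequality through
  \<open>zt k\<close>, and below by \<open>m / 2\<close> times one after it.\<close>

lemma contraction:
  assumes "1 \<le> k" and x: "x \<in> op_zeros (op_sum S T)"
  shows "breg w (z k) x + \<eta> k \<le> (1 - rate) * (breg w (z (k - 1)) x + \<eta> (k - 1))"
proof -
  let ?c = "inverse (1 / (1 - \<sigma>) + 1 / (\<mu> * lam_min))"
  let ?a = "p (z (k - 1) - zt k)" and ?b = "p (zt k - x)"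
  have xZ: "x \<in> Z" using x zeros_subset by blast
  note it = iterate[OF assms(1)]
  have c: "0 \<le> ?c" using params \<mu> by simp
  have D: "0 \<le> breg w (z (k - 1)) x" using breg_nonneg z_in_Z xZ by blast
  have "rate * breg w (z (k - 1)) x \<le> m / M * ?c * breg w (z (k - 1)) x"
    using D by (intro mult_right_mono) (auto simp: rate_def)
  also have "\<dots> \<le> m / M * ?c * (M / 2 * (p (z (k - 1) - x))\<^sup>2)"
    using breg_le[OF z_in_Z xZ] c m M by (intro mult_left_mono) auto
  also have "\<dots> = m / 2 * (?c * (p (z (k - 1) - x))\<^sup>2)"
    using M by simp
  \<comment> \<open>The weights are the coefficients of the two gain terms in
    \<open>descent\<close>.\<close>
  also have "\<dots> \<le> m / 2 * ((1 - \<sigma>) * ?a\<^sup>2 + \<mu> * lam_min * ?b\<^sup>2)"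
    using params \<mu> m seminorm_nonneg seminorm_triangle
    by (intro mult_left_mono weighted_square_sum) auto
  also have "\<dots> = (1 - \<sigma>) * (m / 2 * ?a\<^sup>2) + \<mu> * lam_min * (m / 2 * ?b\<^sup>2)"
    by (simp only: distrib_left mult.left_commute)
  also have "\<dots> \<le> (1 - \<sigma>) * breg w (z (k - 1)) (zt k) + \<mu> * lam_min * breg w (zt k) x"
    using params \<mu> by (intro add_mono mult_left_mono breg_ge z_in_Z it xZ) auto
  finally have "rate * breg w (z (k - 1)) x
      \<le> (1 - \<sigma>) * breg w (z (k - 1)) (zt k) + \<mu> * lam_min * breg w (zt k) x" .
  moreover have "rate * \<eta> (k - 1) \<le> \<tau> * \<eta> (k - 1)"
    using \<eta>_nonneg rate_bounds by (intro mult_right_mono) auto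
  ultimately show ?thesis
    using descent[OF assms] by (simp add: algebra_simps)
qed

lemma linear_rate:
  assumes "x \<in> op_zeros (op_sum S T)"
  shows "breg w (z k) x + \<eta> k \<le> (1 - rate) ^ k * (breg w (z 0) x + \<eta> 0)"
proof (induction k)
  case (Suc k)
  have "breg w (z (Suc k)) x + \<eta> (Suc k) \<le> (1 - rate) * (breg w (z k) x + \<eta> k)"
    using contraction[of "Suc k" x] assms by simp
  also have "\<dots> \<le> (1 - rate) * ((1 - rate) ^ k * (breg w (z 0) x + \<eta> 0))"
    using Suc rate_bounds by (intro mult_left_mono) auto
  finally show ?case by (simp add: mult.assoc)
qed simp

section \<open>Bounds on the errors and the residuals\<close>

text \<open>\<open>descent\<close> bounds \<open>breg w (z (k - 1)) (zt k)\<close> by the energy at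
  \<open>k - 1\<close> divided by \<open>1 - \<sigma>\<close>, and the error criterion turns this
  into a bound on \<open>\<epsilon> k\<close>; hence the exponent \<open>k - 1\<close>.\<close>

lemma \<epsilon>_le:
  assumes k: "1 \<le> k" and x: "x \<in> op_zeros (op_sum S T)"
  shows "\<epsilon> k \<le> 1 / (lam_min * (1 - \<sigma>)) * (1 - rate) ^ (k - 1) * (breg w (z 0) x + \<eta> 0)"
proof -
  let ?E = "breg w (z (k - 1)) x + \<eta> (k - 1)"
  let ?D = "breg w (z (k - 1)) (zt k)"
  have xZ: "x \<in> Z" using x zeros_subset by blast
  note it = iterate[OF k]
  have shrunk: "(1 - \<tau>) * \<eta> (k - 1) \<le> \<eta> (k - 1)"
    using params \<eta>_nonneg by (simp add: algebra_simps)
  have "0 \<le> \<mu> * lam_min * breg w (zt k) x"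
    using params \<mu> breg_nonneg[OF it(2) xZ] by simp
  then have "(1 - \<sigma>) * ?D \<le> ?E"
    using descent[OF assms] shrunk breg_nonneg[OF z_in_Z xZ, of k] \<eta>_nonneg[of k] by linarith
  then have "\<sigma> * ((1 - \<sigma>) * ?D) \<le> \<sigma> * ?E"
    using params by (intro mult_left_mono) auto
  moreover have "lam_min * \<epsilon> k \<le> \<sigma> * ?D + \<eta> (k - 1)"
    using error_criterion[OF k] breg_nonneg[OF z_in_Z it(2), of k] \<eta>_nonneg[of k] shrunk
      mult_right_mono[OF it(1) it(3)] by linarith
  then have "(1 - \<sigma>) * (lam_min * \<epsilon> k) \<le> (1 - \<sigma>) * (\<sigma> * ?D + \<eta> (k - 1))"
    using params by (intro mult_left_mono) auto
  \<comment> \<open>\<open>\<sigma> * ?E + (1 - \<sigma>) * \<eta> (k - 1)\<close> falls short of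
    \<open>?E\<close> by exactly this term.\<close>
  moreover have "0 \<le> (1 - \<sigma>) * breg w (z (k - 1)) x"
    using params breg_nonneg[OF z_in_Z xZ] by simp
  ultimately have "(1 - \<sigma>) * (lam_min * \<epsilon> k) \<le> ?E"
    by (simp add: algebra_simps)
  also have "\<dots> \<le> (1 - rate) ^ (k - 1) * (breg w (z 0) x + \<eta> 0)"
    by (rule linear_rate[OF x])
  finally show ?thesis
    using params by (simp add: field_simps)
qed

text \<open>Both \<open>z (k - 1)\<close> and \<open>z k\<close> lie within
  \<open>sqrt (2 * E / m)\<close> of \<open>x\<close>, where \<open>E\<close> is the energy bound at
  \<open>k - 1\<close>; this gives the factor 2 and the exponent.\<close>

lemma step_seminorm_le:
  assumes k: "1 \<le> k" and x: "x \<in> op_zeros (op_sum S T)"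
  shows "p (z (k - 1) - z k)
    \<le> 2 * sqrt 2 / sqrt m * (1 - rate) powr ((real k - 1) / 2) * sqrt (breg w (z 0) x + \<eta> 0)"
proof -
  define E where "E = (1 - rate) ^ (k - 1) * (breg w (z 0) x + \<eta> 0)"
  have xZ: "x \<in> Z" using x zeros_subset by blast
  have dist: "p (z j - x) \<le> sqrt (2 * E / m)" if "breg w (z j) x \<le> E" for j
  proof (rule real_le_rsqrt)
    show "(p (z j - x))\<^sup>2 \<le> 2 * E / m"
      using breg_ge[OF z_in_Z xZ, of j] that m by (simp add: field_simps)
  qed
  have prev: "breg w (z (k - 1)) x + \<eta> (k - 1) \<le> E"
    unfolding E_def by (rule linear_rate[OF x])
  \<comment> \<open>The energy does not grow at step \<open>k\<close>, so the same \<open>E\<close>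
    serves both indices.\<close>
  have "(1 - rate) * (breg w (z (k - 1)) x + \<eta> (k - 1)) \<le> breg w (z (k - 1)) x + \<eta> (k - 1)"
  proof -
    have "0 \<le> rate" using m M \<mu> params by (simp add: rate_def)
    then have "0 \<le> rate * (breg w (z (k - 1)) x + \<eta> (k - 1))"
      using breg_nonneg[OF z_in_Z xZ] \<eta>_nonneg by simp
    then show ?thesis by (simp add: algebra_simps)
  qed
  then have "breg w (z k) x + \<eta> k \<le> E"
    using contraction[OF assms] prev by linarith
  then have "p (z (k - 1) - z k) \<le> 2 * sqrt (2 * E / m)"
    using seminorm_triangle[of "z (k - 1)" "z k" x] seminorm_minus_commute[OF p, of x "z k"]
      dist[of "k - 1"] dist[of k] prev \<eta>_nonneg[of k] \<eta>_nonneg[of "k - 1"] by linarith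
  also have "\<dots> = 2 * sqrt 2 / sqrt m * sqrt ((1 - rate) ^ (k - 1)) * sqrt (breg w (z 0) x + \<eta> 0)"
    by (simp add: E_def real_sqrt_mult real_sqrt_divide)
  also have "sqrt ((1 - rate) ^ (k - 1)) = (1 - rate) powr ((real k - 1) / 2)"
    using rate_bounds k
    by (simp add: powr_half_sqrt[symmetric] powr_realpow[symmetric] powr_powr of_nat_diff)
  finally show ?thesis .
qed

text \<open>On the unit ball of \<open>p\<close> the Lipschitz bound controls the gradient
  difference, and dividing by \<open>lam k\<close> costs at most a division by
  \<open>lam_min\<close>.\<close>

lemma dual_seminorm_residual_le:
  assumes "1 \<le> k"
  shows "dual_seminorm p (residual w z lam k) \<le> ereal (M / lam_min * p (z (k - 1) - z k))"
  unfolding dual_seminorm_def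
proof (rule SUP_least)
  fix u assume "u \<in> {u. p u \<le> 1}"
  then have u: "p u \<le> 1" by simp
  let ?g = "egradient w (z (k - 1)) - egradient w (z k)" and ?b = "M * p (z (k - 1) - z k)"
  have b: "0 \<le> ?b" using M seminorm_nonneg by simp
  have lam: "lam_min \<le> lam k" "0 < lam k" using iterate(1)[OF assms] params by auto
  have "?g \<bullet> u \<le> ?b * p u"
    by (rule inner_le_dual_seminorm[OF p egradient_lipschitz[OF z_in_Z z_in_Z]])
  also have "\<dots> \<le> ?b" using b u by (rule mult_left_le[rotated])
  finally have "?g \<bullet> u / lam k \<le> ?b / lam k"
    using lam by (simp add: divide_right_mono)
  then have "residual w z lam k \<bullet> u \<le> ?b / lam k"
    by (simp add: residual_eq)
  also have "\<dots> \<le> ?b / lam_min"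
    using b lam params by (intro divide_left_mono) auto
  finally show "ereal (residual w z lam k \<bullet> u) \<le> ereal (M / lam_min * p (z (k - 1) - z k))"
    by simp
qed

end

section \<open>Passage to the infimum over the zeros\<close>

theorem proposition2p7:
  fixes w :: "'a::euclidean_space \<Rightarrow> ereal"
    and p :: "'a \<Rightarrow> real"
    and Z :: "'a set"
    and S T :: "'a \<Rightarrow> 'a set"
    and m M \<mu> \<sigma> \<tau> lam_min \<tau>\<^sub>0 d\<^sub>0 :: real
    and z zt :: "nat \<Rightarrow> 'a"
    and lam \<epsilon> \<eta> :: "nat \<Rightarrow> real"
  assumes "distance_generating w"
    and "is_seminorm p"
    and "convex Z" and "Z \<subseteq> interior (edom w)"
    and "0 < m" and "0 < M" and "regular_wrt w m M Z p"
    and "maximal_monotone S" and "maximal_monotone T"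
    and "op_dom T \<subseteq> Z"
    and "0 < \<mu>" and "bregman_monotone_on w \<mu> Z S"
    and "op_zeros (op_sum S T) \<noteq> {}"
    and "framework1 w S T Z \<sigma> \<tau> lam_min z zt lam \<epsilon> \<eta>"
    and "\<tau>\<^sub>0 = min (m / M * inverse (1 / (1 - \<sigma>) + 1 / (\<mu> * lam_min))) \<tau>"
    and "d\<^sub>0 = real_of_ereal (INF x\<in>op_zeros (op_sum S T). bregman w (z 0) x)"
  shows "\<forall>k\<ge>1.
      residual w z lam k \<in> op_sum S (enlargement T (\<epsilon> k)) (zt k) \<and>
      dual_seminorm p (residual w z lam k)
        \<le> ereal (2 * sqrt 2 * M / (lam_min * sqrt m)
                  * (1 - \<tau>\<^sub>0) powr ((real k - 1) / 2) * sqrt (d\<^sub>0 + \<eta> 0)) \<and>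
      \<epsilon> k \<le> 1 / (lam_min * (1 - \<sigma>)) * (1 - \<tau>\<^sub>0) ^ (k - 1) * (d\<^sub>0 + \<eta> 0)"
proof -
  interpret hpe_regular w p Z S T m M \<mu> \<sigma> \<tau> lam_min z zt lam \<epsilon> \<eta>
    by unfold_locales (fact assms)+
  let ?A = "op_zeros (op_sum S T)"
  have \<tau>\<^sub>0: "\<tau>\<^sub>0 = rate" using assms(15) by (simp add: rate_def)
  have nonneg: "0 \<le> breg w (z 0) x" if "x \<in> ?A" for x
    using that zeros_subset breg_nonneg z_in_Z by blast
  have "(INF x\<in>?A. bregman w (z 0) x) = (INF x\<in>?A. ereal (breg w (z 0) x))"
    using zeros_subset z_in_Z bregman_Z by (intro INF_cong) auto
  then have d\<^sub>0: "d\<^sub>0 = Inf (breg w (z 0) ` ?A)"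
    using assms(16) real_of_ereal_INF[OF assms(13) nonneg] by simp
  \<comment> \<open>Bounds valid for every zero pass to \<open>d\<^sub>0\<close> by continuity,
    without a zero attaining the infimum.\<close>
  have pass: "X \<le> f d\<^sub>0"
    if "continuous_on UNIV f" "\<And>x. x \<in> ?A \<Longrightarrow> X \<le> f (breg w (z 0) x)" for X and f :: "real \<Rightarrow> real"
    unfolding d\<^sub>0
  proof (rule le_continuous_Inf[OF that(1)])
    show "bdd_below (breg w (z 0) ` ?A)"
      by (rule bdd_belowI2[OF nonneg])
  qed (use that(2) assms(13) in auto)
  show ?thesis
  proof (intro allI impI conjI)
    fix k :: nat assume k: "1 \<le> k"
    show "residual w z lam k \<in> op_sum S (enlargement T (\<epsilon> k)) (zt k)"
      by (rule iterate(4)[OF k])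
    show "\<epsilon> k \<le> 1 / (lam_min * (1 - \<sigma>)) * (1 - \<tau>\<^sub>0) ^ (k - 1) * (d\<^sub>0 + \<eta> 0)"
      unfolding \<tau>\<^sub>0 by (rule pass) (intro continuous_intros, rule \<epsilon>_le[OF k])
    have "p (z (k - 1) - z k)
        \<le> 2 * sqrt 2 / sqrt m * (1 - \<tau>\<^sub>0) powr ((real k - 1) / 2) * sqrt (d\<^sub>0 + \<eta> 0)"
      \<comment> \<open>\<open>sqrt\<close> is continuous on the whole real line, so the bound is
        continuous in \<open>d\<^sub>0\<close> on \<open>UNIV\<close>, as \<open>pass\<close>
        asks.\<close>
      unfolding \<tau>\<^sub>0 by (rule pass) (intro continuous_intros, rule step_seminorm_le[OF k])
    then have "M / lam_min * p (z (k - 1) - z k) \<le> M / lam_min *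
        (2 * sqrt 2 / sqrt m * (1 - \<tau>\<^sub>0) powr ((real k - 1) / 2) * sqrt (d\<^sub>0 + \<eta> 0))"
      using M params by (intro mult_left_mono) auto
    then have "ereal (M / lam_min * p (z (k - 1) - z k))
        \<le> ereal (2 * sqrt 2 * M / (lam_min * sqrt m)
                  * (1 - \<tau>\<^sub>0) powr ((real k - 1) / 2) * sqrt (d\<^sub>0 + \<eta> 0))"
      by (simp add: mult_ac)
    with dual_seminorm_residual_le[OF k]
    show "dual_seminorm p (residual w z lam k)
        \<le> ereal (2 * sqrt 2 * M / (lam_min * sqrt m)
                  * (1 - \<tau>\<^sub>0) powr ((real k - 1) / 2) * sqrt (d\<^sub>0 + \<eta> 0))"
      by (rule order_trans)
  qed
qed

end
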